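(* Let $\phi(x) = x^d + c$, where $c,d \in \mathbb{Z}$ and $d \geq 2$, and let $P_{d,c}$ be the set of primes $p$ such that $p \mid \phi^p(0)$. If $d$ is even, then $$P_{d,c} = \{2\} \cup \{p \text{ prime} : p \mid c\}.$$
   Context: Here $\phi^n$ denotes the $n$-th iterate of $\phi$. *)

theory Defs
  imports "HOL-Computational_Algebra.Primes"
begin

definition phi :: "nat \<Rightarrow> int \<Rightarrow> int \<Rightarrow> int" where
  "phi d c x = x ^ d + c"

definition P :: "nat \<Rightarrow> int \<Rightarrow> nat set" where
  "P d c = {p. prime p \<and> int p dvd (phi d c ^^ p) 0}"

end

theory Submission
  imports Defs "HOL-Number_Theory.Cong"
begin

text \<open>If \<open>p\<close> divides \<open>\<phi>\<^sup>p(0)\<close> but not \<open>c\<close>, then \<open>0\<close> is periodic modulo \<open>p\<close> with period exactly \<open>p\<close>,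
  so its orbit is all of \<open>\<int>/p\<close> and \<open>\<phi>\<close> permutes the residues. For even \<open>d\<close> this contradicts
  \<open>\<phi>(1) = \<phi>(-1)\<close> unless \<open>p = 2\<close>.\<close>

lemma cong_phi: "[x = y] (mod m) \<Longrightarrow> [phi d c x = phi d c y] (mod m)"
  unfolding phi_def by (intro cong_add cong_pow cong_refl)

lemma cong_funpow_phi:
  "[x = y] (mod m) \<Longrightarrow> [(phi d c ^^ n) x = (phi d c ^^ n) y] (mod m)"
  by (induction n) (auto intro: cong_phi)

lemma cong_funpow_phi_mult:
  assumes "[(phi d c ^^ k) x = x] (mod m)"
  shows "[(phi d c ^^ (a * k)) x = x] (mod m)"
proof (induction a)
  case (Suc a)
  have "[(phi d c ^^ k) ((phi d c ^^ (a * k)) x) = (phi d c ^^ k) x] (mod m)"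
    by (rule cong_funpow_phi[OF Suc])
  then show ?case
    using assms by (auto simp: funpow_add intro: cong_trans)
qed simp

text \<open>Bezout over the naturals, which takes \<open>k > 0\<close>, gives a multiple of
  \<open>k\<close> that is one more than a multiple of \<open>n\<close>. At that time the orbit of 0
  is back at 0, yet it has also just taken one step from 0, so it sits at \<open>c\<close> modulo
  \<open>m\<close>.\<close>

lemma dvd_const_of_coprime_periods:
  assumes "[(phi d c ^^ k) 0 = 0] (mod m)" "[(phi d c ^^ n) 0 = 0] (mod m)"
    and "coprime k n" "k > 0" "d > 0"
  shows "m dvd c"
proof -
  obtain a b where ab: "a * k = Suc (b * n)"
    using bezout_nat[of k n] assms(3,4)
    by (metis coprime_iff_gcd_eq_1 Suc_eq_plus1 less_not_refl mult.commute)
  have "[(phi d c ^^ (a * k)) 0 = 0] (mod m)"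
    by (rule cong_funpow_phi_mult[OF assms(1)])
  moreover have "[(phi d c ^^ (a * k)) 0 = phi d c 0] (mod m)"
    unfolding ab using cong_phi[OF cong_funpow_phi_mult[OF assms(2)]] by simp
  ultimately have "[phi d c 0 = 0] (mod m)"
    by (metis cong_sym cong_trans)
  then show ?thesis
    using \<open>d > 0\<close> by (simp add: phi_def cong_0_iff zero_power)
qed

text \<open>If times \<open>i < j\<close> gave the same residue, \<open>p - j\<close> further steps
  would carry time \<open>j\<close> to the return at time \<open>p\<close>. So 0 would also recur at
  time \<open>p - j + i\<close>, which lies strictly between 0 and \<open>p\<close> and is thus
  coprime to \<open>p\<close>.\<close>

lemma orbit_inj_on:
  assumes "prime p" "[(phi d c ^^ p) 0 = 0] (mod int p)" "\<not> int p dvd c" "d > 0"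
  shows "inj_on (\<lambda>i. (phi d c ^^ i) 0 mod int p) {1..p}"
proof (rule linorder_inj_onI)
  fix i j assume ij: "i < j" "i \<in> {1..p}" "j \<in> {1..p}"
  show "(phi d c ^^ i) 0 mod int p \<noteq> (phi d c ^^ j) 0 mod int p"
  proof
    assume "(phi d c ^^ i) 0 mod int p = (phi d c ^^ j) 0 mod int p"
    then have "[(phi d c ^^ (p - j)) ((phi d c ^^ i) 0)
        = (phi d c ^^ (p - j)) ((phi d c ^^ j) 0)] (mod int p)"
      by (intro cong_funpow_phi) (simp add: cong_def)
    then have "[(phi d c ^^ (p - j + i)) 0 = (phi d c ^^ (p - j + j)) 0] (mod int p)"
      by (simp only: funpow_add o_apply)
    then have "[(phi d c ^^ (p - j + i)) 0 = 0] (mod int p)"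
      using assms(2) ij by (auto intro: cong_trans)
    moreover have "coprime (p - j + i) p"
      using ij assms(1)
      by (metis (no_types, lifting) add_gr_0 atLeastAtMost_iff coprime_commute le_add_diff_inverse2
          nat_add_left_cancel_less nat_dvd_not_less not_one_le_zero not_gr_zero prime_imp_coprime)
    ultimately show False
      using dvd_const_of_coprime_periods assms ij by fastforce
  qed
qed auto

lemma orbit_image:
  assumes "prime p" "[(phi d c ^^ p) 0 = 0] (mod int p)" "\<not> int p dvd c" "d > 0"
  shows "(\<lambda>i. (phi d c ^^ i) 0 mod int p) ` {1..p} = {0..<int p}"
proof (rule card_subset_eq)
  show "card ((\<lambda>i. (phi d c ^^ i) 0 mod int p) ` {1..p}) = card {0..<int p}"
    using card_image[OF orbit_inj_on[OF assms]] by simp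
qed (use prime_gt_0_nat[OF assms(1)] in auto)

lemma dvd_const_of_dvd_orbit:
  assumes p: "prime p" "int p dvd (phi d c ^^ p) 0" and "p \<noteq> 2" "even d" "d > 0"
  shows "int p dvd c"
proof (rule ccontr)
  assume ndvd: "\<not> int p dvd c"
  let ?x = "\<lambda>i. (phi d c ^^ i) 0"
  have per: "[?x p = 0] (mod int p)"
    using p by (simp add: cong_0_iff)
  have gt: "p > 2"
    using p(1) \<open>p \<noteq> 2\<close> prime_ge_2_nat[of p] by simp
  note inj = orbit_inj_on[OF p(1) per ndvd \<open>d > 0\<close>]
  note img = orbit_image[OF p(1) per ndvd \<open>d > 0\<close>]
  \<comment> \<open>These are the canonical representatives of 1 and -1, which an even power
    identifies.\<close>
  have "1 \<in> {0..<int p}" "int p - 1 \<in> {0..<int p}"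
    using gt by auto
  then obtain i j where i: "i \<in> {1..p}" "?x i mod int p = 1"
    and j: "j \<in> {1..p}" "?x j mod int p = int p - 1"
    unfolding img[symmetric] by (metis (no_types, lifting) imageE)
  \<comment> \<open>The orbit is 0 at time \<open>p\<close>, while both chosen residues are nonzero.
    This keeps \<open>Suc i\<close> and \<open>Suc j\<close> inside \<open>{1..p}\<close>, where
    injectivity applies.\<close>
  have "i \<noteq> p" "j \<noteq> p"
    using i j p(2) gt by auto
  have xi: "[?x i = 1] (mod int p)"
    using i gt by (simp add: cong_def)
  have "[?x j = -1] (mod int p)"
    using j gt by (simp add: cong_def zmod_minus1)
  then have "[phi d c (?x i) = phi d c (?x j)] (mod int p)"
    using cong_phi[OF xi, of d c] cong_phi[of "?x j" "-1" "int p" d c] \<open>even d\<close>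
    by (simp add: phi_def) (metis cong_sym cong_trans)
  then have "?x (Suc i) mod int p = ?x (Suc j) mod int p"
    by (simp add: cong_def)
  then have "Suc i = Suc j"
    using i j \<open>i \<noteq> p\<close> \<open>j \<noteq> p\<close> by (intro inj_onD[OF inj]) auto
  \<comment> \<open>Equal times would force 1 and \<open>int p - 1\<close> to coincide, which
    \<open>p > 2\<close> excludes.\<close>
  then show False
    using i j gt by auto
qed

theorem theorem1p6:
  fixes d :: nat and c :: int
  assumes "d \<ge> 2" and "even d"
  shows "P d c = {2} \<union> {p. prime p \<and> int p dvd c}"
proof -
  \<comment> \<open>When \<open>p\<close> divides \<open>c\<close>, 0 is a fixed point modulo
    \<open>p\<close>.\<close>
  have "int p dvd (phi d c ^^ p) 0" if "int p dvd c" for p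
  proof -
    have "[(phi d c ^^ 1) 0 = 0] (mod int p)"
      using that assms(1) by (simp add: phi_def cong_0_iff zero_power)
    from cong_funpow_phi_mult[OF this, of p] show ?thesis
      by (simp add: cong_0_iff)
  qed
  \<comment> \<open>The second iterate is \<open>c ^ d + c\<close>, a sum of two terms of equal
    parity.\<close>
  moreover have "int 2 dvd (phi d c ^^ 2) 0"
    using assms(1) by (simp add: phi_def eval_nat_numeral)
  moreover have "int p dvd c" if "prime p" "int p dvd (phi d c ^^ p) 0" "p \<noteq> 2" for p
    using dvd_const_of_dvd_orbit[OF that] assms by simp
  ultimately show ?thesis
    unfolding P_def by auto
qed

end
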